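(* Let $(M_n)_{n\ge-1}$ be a square-integrable martingale with respect to $(\mathcal{F}_n)_{n\ge-1}$ and let $f:\mathbb{R}\times\{-1,0,1,2,\ldots\}\to\mathbb{R}$. Then for all $n\in\mathbb{N}$, $$f(M_n,n)=f(M_{-1},-1)+\sum_{k=0}^nD_kf(M_k,k)\,Y_k+\sum_{k=0}^nE\big[f(M_k,k)-f(M_{k-1},k-1)\mid\mathcal{F}_{k-1}\big].$$
   Context: $\mathbb{N}=\{0,1,2,\ldots\}$. Let $(p_k)_{k\in\mathbb{N}}$ be a deterministic sequence in $(0,1)$ and $q_k=1-p_k$. Let $\Omega=\{-1,1\}^{\mathbb{N}}$ with its product $\sigma$-algebra, let $X_k:\Omega\to\{-1,1\}$ be the canonical projections, and let $\mathbb{P}$ be the product probability measure under which the $X_k$ are independent with $\mathbb{P}(X_k=1)=p_k$, $\mathbb{P}(X_k=-1)=q_k$. Set $Y_k=\frac{q_k-p_k+X_k}{2\sqrt{p_kq_k}}$, $\mathcal{F}_n=\sigma(X_0,\ldots,X_n)$ for $n\ge0$, $\mathcal{F}_{-1}=\{\emptyset,\Omega\}$. For $F:\Omega\to\mathbb{R}$, $D_kF(\omega)=\sqrt{p_kq_k}\,(F(\omega_+^k)-F(\omega_-^k))$, where $\omega_\pm^k$ is $\omega$ with its $k$-th coordinate replaced by $\pm1$; $D_kf(M_k,k)$ denotes $D_k$ applied to the random variable $f(M_k,k)$. *)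

theory Defs
  imports "HOL-Probability.Probability"
begin

text \<open>
  Sample points are functions of type nat to real with all values in {-1, 1}. The index set
  {-1, 0, 1, ...} of filtrations and processes is the subset {-1..} of type int; values at
  indices below -1 are never used.
\<close>

definition rademacher_space :: "(nat \<Rightarrow> real) \<Rightarrow> (nat \<Rightarrow> real) measure" where
  "rademacher_space p =
     Pi\<^sub>M UNIV (\<lambda>k. point_measure {-1, 1} (\<lambda>x. ennreal (if x = 1 then p k else 1 - p k)))"

definition coord :: "nat \<Rightarrow> (nat \<Rightarrow> real) \<Rightarrow> real" where
  "coord k \<omega> = \<omega> k"

definition normalized_coord :: "(nat \<Rightarrow> real) \<Rightarrow> nat \<Rightarrow> (nat \<Rightarrow> real) \<Rightarrow> real" where
  "normalized_coord p k \<omega> = ((1 - p k) - p k + coord k \<omega>) / (2 * sqrt (p k * (1 - p k)))"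

text \<open>
  For n = -1 no coordinate qualifies, so the generated sigma-algebra is the trivial one. The
  measure carried by the result of sigma is irrelevant: only its space and its sets are used.
\<close>

definition coord_filtration :: "(nat \<Rightarrow> real) \<Rightarrow> int \<Rightarrow> (nat \<Rightarrow> real) measure" where
  "coord_filtration p n =
     sigma (space (rademacher_space p))
       {coord k -` A \<inter> space (rademacher_space p) | k A. int k \<le> n \<and> A \<in> sets borel}"

definition finite_difference ::
    "(nat \<Rightarrow> real) \<Rightarrow> nat \<Rightarrow> ((nat \<Rightarrow> real) \<Rightarrow> real) \<Rightarrow> (nat \<Rightarrow> real) \<Rightarrow> real" where
  "finite_difference p k F \<omega> = sqrt (p k * (1 - p k)) * (F (fun_upd \<omega> k 1) - F (fun_upd \<omega> k (-1)))"

definition square_integrable_martingale ::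
    "'a measure \<Rightarrow> 't::order set \<Rightarrow> ('t \<Rightarrow> 'a measure) \<Rightarrow> ('t \<Rightarrow> 'a \<Rightarrow> real) \<Rightarrow> bool" where
  "square_integrable_martingale P T F M \<longleftrightarrow>
     (\<forall>t\<in>T. M t \<in> borel_measurable (F t) \<and> integrable P (M t) \<and> integrable P (\<lambda>\<omega>. (M t \<omega>)\<^sup>2)) \<and>
     (\<forall>s\<in>T. \<forall>t\<in>T. s \<le> t \<longrightarrow> (AE \<omega> in P. real_cond_exp P (F s) (M t) \<omega> = M s \<omega>))"

lemma space_rademacher_space: "space (rademacher_space p) = {\<omega>. \<forall>k. \<omega> k \<in> {-1, 1}}"
  by (auto simp: rademacher_space_def space_PiM space_point_measure PiE_def Pi_def)

lemma prob_space_rademacher_space: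
  assumes "\<And>k. 0 < p k \<and> p k < 1"
  shows "prob_space (rademacher_space p)"
  unfolding rademacher_space_def
proof (rule prob_space_PiM)
  fix k
  show "prob_space (point_measure {-1, 1} (\<lambda>x::real. ennreal (if x = 1 then p k else 1 - p k)))"
    using assms[of k]
    by (intro prob_spaceI)
       (simp add: space_point_measure emeasure_point_measure_finite ennreal_plus[symmetric]
         del: ennreal_plus)
qed

lemma sets_coord_filtration_minus_one:
  "sets (coord_filtration p (-1)) = {{}, space (rademacher_space p)}"
  by (simp add: coord_filtration_def sigma_sets_empty_eq)

lemma subalgebra_coord_filtration: "subalgebra (rademacher_space p) (coord_filtration p n)"
proof -
  let ?\<Omega> = "rademacher_space p"
  have "coord k \<in> borel_measurable ?\<Omega>" for k
  proof -
    have "(\<lambda>\<omega>. \<omega> k) \<in> ?\<Omega> \<rightarrow>\<^sub>M point_measure {-1, 1} (\<lambda>x. ennreal (if x = 1 then p k else 1 - p k))"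
      unfolding rademacher_space_def by (rule measurable_component_singleton) simp
    moreover have "(\<lambda>x::real. x) \<in>
        point_measure {-1, 1} (\<lambda>x. ennreal (if x = 1 then p k else 1 - p k)) \<rightarrow>\<^sub>M borel"
      by simp
    ultimately show ?thesis
      unfolding coord_def[abs_def] by (rule measurable_compose)
  qed
  then show ?thesis
    unfolding subalgebra_def coord_filtration_def
    by (auto simp: sets_measure_of_conv space_measure_of_conv intro!: sets.sigma_sets_subset measurable_sets)
qed

end

theory Submission
  imports Defs
begin

text \<open>
  Only finitely many coordinates generate each sigma-algebra of the filtration, so measurability
  with respect to it means depending on these coordinates alone; for this reason no measurability
  of \<open>f\<close> is needed and each term of an adapted process is bounded. Each atom is a cylinder
  of positive probability, so almost sure identities between such functions hold at every sample
  point. By independence, conditioning a function of the first \<open>k + 1\<close> coordinates on the first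
  \<open>k\<close> of them averages out the coordinate \<open>k\<close>, and for a two-valued coordinate the deviation
  from this average is exactly the finite difference times the normalized coordinate.
  Summing over \<open>k\<close> telescopes.
\<close>

section \<open>Cylinder sets and their probabilities\<close>

definition cylinder :: "(nat \<Rightarrow> real) \<Rightarrow> nat set \<Rightarrow> (nat \<Rightarrow> real) \<Rightarrow> (nat \<Rightarrow> real) set" where
  "cylinder p J a = {\<omega> \<in> space (rademacher_space p). \<forall>k\<in>J. \<omega> k = a k}"

lemma space_coord_filtration [simp]:
  "space (coord_filtration p n) = space (rademacher_space p)"
  by (simp add: coord_filtration_def space_measure_of_conv)

lemma finite_coord_indices: "finite {k. int k \<le> n}"
  by (rule finite_subset[of _ "{..nat n}"]) auto

lemma fun_upd_in_space:
  assumes "\<omega> \<in> space (rademacher_space p)" "x \<in> {-1, 1}"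
  shows "fun_upd \<omega> k x \<in> space (rademacher_space p)"
  using assms by (auto simp: space_rademacher_space)

lemma sets_cylinder:
  assumes "\<And>k. k \<in> J \<Longrightarrow> int k \<le> n" "finite J"
  shows "cylinder p J a \<in> sets (coord_filtration p n)"
proof -
  have "coord k -` {a k} \<inter> space (rademacher_space p) \<in> sets (coord_filtration p n)" if "k \<in> J" for k
  proof -
    have "{a k} \<in> sets (borel :: real measure)" by simp
    with assms(1)[OF that] show ?thesis
      unfolding coord_filtration_def by (subst sets_measure_of) blast+
  qed
  then have "{\<omega> \<in> space (coord_filtration p n). \<omega> k = a k} \<in> sets (coord_filtration p n)"
    if "k \<in> J" for k
    using that by (simp add: vimage_def coord_def Int_def conj_commute)
  then have "{\<omega> \<in> space (coord_filtration p n). \<forall>k\<in>J. \<omega> k = a k} \<in> sets (coord_filtration p n)"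
    using assms(2) by (rule sets.sets_Collect_finite_All)
  then show ?thesis
    by (simp add: cylinder_def)
qed

lemma sets_rademacher_space_cylinder:
  assumes "finite J"
  shows "cylinder p J a \<in> sets (rademacher_space p)"
proof -
  \<comment> \<open>For empty \<open>J\<close> the value \<open>Max J\<close> is unspecified, but
    then the bound on the indices holds vacuously.\<close>
  have "cylinder p J a \<in> sets (coord_filtration p (int (Max J)))"
    using assms by (intro sets_cylinder) auto
  then show ?thesis
    using subalgebra_coord_filtration[of p] by (auto simp: subalgebra_def)
qed

text \<open>A cylinder over \<open>J\<close> is the embedding of a box of singletons, so the product
  measure multiplies the point masses of the factors.\<close>

lemma measure_cylinder:
  assumes p: "\<And>k. 0 < p k \<and> p k < 1"
    and J: "finite J" and a: "\<And>k. k \<in> J \<Longrightarrow> a k \<in> {-1, 1}"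
  shows "measure (rademacher_space p) (cylinder p J a) = (\<Prod>k\<in>J. if a k = 1 then p k else 1 - p k)"
proof -
  let ?B = "\<lambda>k. point_measure {-1, 1::real} (\<lambda>x. ennreal (if x = 1 then p k else 1 - p k))"
  have B: "prob_space (?B k)" for k
    using p[of k]
    by (intro prob_spaceI)
       (simp add: space_point_measure emeasure_point_measure_finite ennreal_plus[symmetric]
         del: ennreal_plus)
  interpret B: product_prob_space ?B UNIV
    by (intro product_prob_spaceI B)
  have "cylinder p J a = prod_emb UNIV ?B J (Pi\<^sub>E J (\<lambda>k. {a k}))"
    by (auto simp: cylinder_def prod_emb_def space_rademacher_space space_point_measure
        restrict_def PiE_def extensional_def Pi_iff)
  then have "measure (rademacher_space p) (cylinder p J a) = (\<Prod>k\<in>J. measure (?B k) {a k})"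
    using J a by (simp add: rademacher_space_def B.measure_PiM_emb sets_point_measure)
  also have "\<dots> = (\<Prod>k\<in>J. if a k = 1 then p k else 1 - p k)"
    using a p by (intro prod.cong refl)
      (auto simp: measure_def emeasure_point_measure_finite less_imp_le)
  finally show ?thesis .
qed

section \<open>Measurability as dependence on finitely many coordinates\<close>

lemma coord_filtration_set_cong:
  assumes "A \<in> sets (coord_filtration p n)"
    and "\<omega> \<in> space (rademacher_space p)" "\<omega>' \<in> space (rademacher_space p)"
    and "\<And>k. int k \<le> n \<Longrightarrow> \<omega> k = \<omega>' k"
  shows "\<omega> \<in> A \<longleftrightarrow> \<omega>' \<in> A"
proof -
  let ?G = "{coord k -` A \<inter> space (rademacher_space p) | k A. int k \<le> n \<and> A \<in> sets borel}"
  have "?G \<subseteq> Pow (space (rademacher_space p))"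
    by blast
  then have "A \<in> sigma_sets (space (rademacher_space p)) ?G"
    using assms(1) by (simp add: coord_filtration_def)
  then show ?thesis
  \<comment> \<open>Not separating points that agree up to index \<open>n\<close> holds for the
    generators and survives complements and countable unions.\<close>
  proof induction
    case (Basic a)
    then show ?case using assms(2-4) by (auto simp: coord_def)
  qed (use assms(2,3) in auto)
qed

text \<open>The level set of \<open>g\<close> through \<omega> belongs to the sigma-algebra, so it
  cannot separate \<omega> from a point with the same coordinates up to \<open>n\<close>.\<close>

lemma coord_filtration_measurable_cong:
  fixes g :: "(nat \<Rightarrow> real) \<Rightarrow> real"
  assumes "g \<in> borel_measurable (coord_filtration p n)"
    and "\<omega> \<in> space (rademacher_space p)" "\<omega>' \<in> space (rademacher_space p)"
    and "\<And>k. int k \<le> n \<Longrightarrow> \<omega> k = \<omega>' k"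
  shows "g \<omega> = g \<omega>'"
proof -
  have "g -` {g \<omega>} \<inter> space (coord_filtration p n) \<in> sets (coord_filtration p n)"
    by (rule measurable_sets[OF assms(1)]) simp
  from coord_filtration_set_cong[OF this assms(2-4)] show ?thesis
    using assms(2,3) by auto
qed

text \<open>The traces on \<open>J\<close> of the points of \<open>A\<close> index the cylinders;
  two-valued coordinates leave only finitely many traces. Indexing by extensional functions ensures
  that distinct indices differ at some point of \<open>J\<close>, so that their cylinders are
  disjoint.\<close>

lemma cylinder_decomposition:
  assumes "A \<subseteq> space (rademacher_space p)" "finite J"
    and dep: "\<And>\<omega> \<omega>'. \<omega> \<in> A \<Longrightarrow> \<omega>' \<in> space (rademacher_space p) \<Longrightarrow>
      (\<And>k. k \<in> J \<Longrightarrow> \<omega>' k = \<omega> k) \<Longrightarrow> \<omega>' \<in> A"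
  obtains C where "finite C" "C \<subseteq> Pi\<^sub>E J (\<lambda>_. {-1, 1})" "A = (\<Union>c\<in>C. cylinder p J c)"
proof
  let ?C = "(\<lambda>\<omega>. restrict \<omega> J) ` A"
  show sub: "?C \<subseteq> Pi\<^sub>E J (\<lambda>_. {-1, 1})"
    using assms(1) by (force simp: space_rademacher_space restrict_PiE_iff)
  show "finite ?C"
    using assms(2) by (intro finite_subset[OF sub] finite_PiE) auto
  show "A = (\<Union>c\<in>?C. cylinder p J c)"
    using assms(1) dep by (auto simp: cylinder_def)
qed

text \<open>Every preimage under \<open>g\<close> is a finite union of cylinders. Being the converse
  of \<open>coord_filtration_measurable_cong\<close>, this reduces measurability proofs to checking
  which coordinates matter.\<close>

lemma borel_measurable_coord_filtrationI:
  fixes g :: "(nat \<Rightarrow> real) \<Rightarrow> real"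
  assumes "\<And>\<omega> \<omega>'. \<omega> \<in> space (rademacher_space p) \<Longrightarrow> \<omega>' \<in> space (rademacher_space p) \<Longrightarrow>
      (\<And>k. int k \<le> n \<Longrightarrow> \<omega>' k = \<omega> k) \<Longrightarrow> g \<omega>' = g \<omega>"
  shows "g \<in> borel_measurable (coord_filtration p n)"
proof (rule measurableI)
  fix B :: "real set"
  let ?J = "{k. int k \<le> n}"
  obtain C where C: "finite C" "g -` B \<inter> space (rademacher_space p) = (\<Union>c\<in>C. cylinder p ?J c)"
  proof (rule cylinder_decomposition)
    show "\<omega>' \<in> g -` B \<inter> space (rademacher_space p)"
      if "\<omega> \<in> g -` B \<inter> space (rademacher_space p)" "\<omega>' \<in> space (rademacher_space p)"
        "\<And>k. k \<in> ?J \<Longrightarrow> \<omega>' k = \<omega> k" for \<omega> \<omega>'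
      using assms[of \<omega> \<omega>'] that by simp
  qed (use finite_coord_indices in auto)
  show "g -` B \<inter> space (coord_filtration p n) \<in> sets (coord_filtration p n)"
    unfolding space_coord_filtration C(2)
    using C(1) finite_coord_indices by (intro sets.finite_UN sets_cylinder) auto
qed simp

text \<open>Finitely many sign patterns determine \<open>g\<close>, so its range is finite, and a
  bounded measurable function on a probability space is integrable.\<close>

lemma integrable_coord_filtration:
  fixes g :: "(nat \<Rightarrow> real) \<Rightarrow> real"
  assumes p: "\<And>k. 0 < p k \<and> p k < 1"
    and g: "g \<in> borel_measurable (coord_filtration p n)"
  shows "integrable (rademacher_space p) g"
proof -
  interpret prob_space "rademacher_space p"
    by (rule prob_space_rademacher_space[OF p])
  let ?J = "{k. int k \<le> n}" and ?S = "space (rademacher_space p)"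
  \<comment> \<open>Coordinates beyond \<open>n\<close> do not influence \<open>g\<close>; filling
    them with the admissible value 1 turns a sign pattern into a sample point.\<close>
  define ext :: "(nat \<Rightarrow> real) \<Rightarrow> nat \<Rightarrow> real" where "ext c k = (if int k \<le> n then c k else 1)" for c k
  have "g ` ?S \<subseteq> (\<lambda>c. g (ext c)) ` Pi\<^sub>E ?J (\<lambda>_. {-1, 1})"
  proof
    fix y assume "y \<in> g ` ?S"
    then obtain \<omega> where \<omega>: "\<omega> \<in> ?S" "y = g \<omega>" by blast
    have "g \<omega> = g (ext (restrict \<omega> ?J))"
      using \<omega>(1) by (intro coord_filtration_measurable_cong[OF g])
        (auto simp: ext_def space_rademacher_space)
    moreover have "restrict \<omega> ?J \<in> Pi\<^sub>E ?J (\<lambda>_. {-1, 1})"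
      using \<omega>(1) by (auto simp: space_rademacher_space restrict_PiE_iff)
    ultimately show "y \<in> (\<lambda>c. g (ext c)) ` Pi\<^sub>E ?J (\<lambda>_. {-1, 1})"
      using \<omega>(2) by blast
  qed
  moreover have "finite (Pi\<^sub>E ?J (\<lambda>_. {-1, 1::real}))"
    by (intro finite_PiE finite_coord_indices) auto
  ultimately have "finite (g ` ?S)"
    by (meson finite_imageI finite_subset)
  then have "bounded (g ` ?S)"
    by (rule finite_imp_bounded)
  then obtain B where "\<And>\<omega>. \<omega> \<in> ?S \<Longrightarrow> norm (g \<omega>) \<le> B"
    by (auto simp: bounded_iff)
  moreover have "g \<in> borel_measurable (rademacher_space p)"
    by (rule measurable_from_subalg[OF subalgebra_coord_filtration g])
  ultimately show ?thesis
    by (intro integrable_const_bound[of _ B] AE_I2)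
qed

text \<open>A disagreement at \<omega> would spread to the whole cylinder through \<omega>, which
  has positive probability. This is what turns almost sure properties of
  \<open>real_cond_exp\<close> into equations at a given sample point.\<close>

lemma coord_filtration_AE_eq_imp_eq:
  fixes g h :: "(nat \<Rightarrow> real) \<Rightarrow> real"
  assumes p: "\<And>k. 0 < p k \<and> p k < 1"
    and g: "g \<in> borel_measurable (coord_filtration p n)"
    and h: "h \<in> borel_measurable (coord_filtration p n)"
    and ae: "AE \<omega> in rademacher_space p. g \<omega> = h \<omega>"
    and \<omega>: "\<omega> \<in> space (rademacher_space p)"
  shows "g \<omega> = h \<omega>"
proof (rule ccontr)
  assume neq: "g \<omega> \<noteq> h \<omega>"
  let ?C = "cylinder p {k. int k \<le> n} \<omega>"
  have "g \<omega>' \<noteq> h \<omega>'" if "\<omega>' \<in> ?C" for \<omega>'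
    using neq that coord_filtration_measurable_cong[OF g \<omega>, of \<omega>']
      coord_filtration_measurable_cong[OF h \<omega>, of \<omega>']
    by (auto simp: cylinder_def)
  then have "AE \<omega>' in rademacher_space p. \<omega>' \<notin> ?C"
    using ae by (auto elim!: eventually_mono)
  then have "measure (rademacher_space p) ?C = 0"
    using sets_rademacher_space_cylinder[OF finite_coord_indices]
    by (simp add: AE_iff_null_sets[symmetric] null_setsD1 measure_def)
  moreover have "measure (rademacher_space p) ?C > 0"
    using \<omega> p by (subst measure_cylinder[OF p finite_coord_indices])
      (auto simp: space_rademacher_space intro!: prod_pos)
  ultimately show False by simp
qed

section \<open>Averaging over a single coordinate\<close>

lemma measure_Int_coord_eq_1:
  assumes p: "\<And>k. 0 < p k \<and> p k < 1"
    and A: "A \<in> sets (coord_filtration p (int k - 1))"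
  shows "measure (rademacher_space p) (A \<inter> cylinder p {k} (\<lambda>_. 1))
    = p k * measure (rademacher_space p) A"
proof -
  let ?P = "rademacher_space p"
  interpret prob_space ?P by (rule prob_space_rademacher_space[OF p])
  have "A \<subseteq> space ?P"
    using sets.sets_into_space[OF A] by simp
  \<comment> \<open>Since \<open>int j \<le> int k - 1\<close> means \<open>j < k\<close>, the set
    \<open>A\<close> is a union of cylinders over \<open>{..<k}\<close>, and the claim reduces to
    one cylinder at a time.\<close>
  obtain C where C: "finite C" "C \<subseteq> Pi\<^sub>E {..<k} (\<lambda>_. {-1, 1})" "A = (\<Union>c\<in>C. cylinder p {..<k} c)"
  proof (rule cylinder_decomposition[OF \<open>A \<subseteq> space ?P\<close>, of "{..<k}"])
    show "\<omega>' \<in> A" if "\<omega> \<in> A" "\<omega>' \<in> space ?P" "\<And>j. j \<in> {..<k} \<Longrightarrow> \<omega>' j = \<omega> j" for \<omega> \<omega>'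
      using coord_filtration_set_cong[OF A, of \<omega> \<omega>'] that \<open>A \<subseteq> space ?P\<close> by auto
  qed auto
  have disj: "disjoint_family_on (\<lambda>c. cylinder p {..<k} c) C"
    unfolding disjoint_family_on_def
  proof (intro ballI impI)
    fix c d assume cd: "c \<in> C" "d \<in> C" "c \<noteq> d"
    then have "c \<in> Pi\<^sub>E {..<k} (\<lambda>_. {-1, 1})" "d \<in> Pi\<^sub>E {..<k} (\<lambda>_. {-1, 1})"
      using C(2) by blast+
    with \<open>c \<noteq> d\<close> obtain j where "j < k" "c j \<noteq> d j"
      by (meson PiE_ext lessThan_iff)
    then show "cylinder p {..<k} c \<inter> cylinder p {..<k} d = {}"
      by (auto simp: cylinder_def)
  qed
  have ins: "cylinder p {..<k} c \<inter> cylinder p {k} (\<lambda>_. 1) = cylinder p (insert k {..<k}) (fun_upd c k 1)" for c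
    by (auto simp: cylinder_def)
  have "measure ?P (A \<inter> cylinder p {k} (\<lambda>_. 1))
      = measure ?P (\<Union>c\<in>C. cylinder p {..<k} c \<inter> cylinder p {k} (\<lambda>_. 1))"
    by (simp add: C(3) Int_UN_distrib2 Int_commute)
  also have "\<dots> = (\<Sum>c\<in>C. measure ?P (cylinder p {..<k} c \<inter> cylinder p {k} (\<lambda>_. 1)))"
    using disj C(1) by (intro finite_measure_finite_Union)
      (auto simp: disjoint_family_on_def intro!: sets_rademacher_space_cylinder)
  also have "\<dots> = (\<Sum>c\<in>C. p k * measure ?P (cylinder p {..<k} c))"
  proof (intro sum.cong refl)
    fix c assume "c \<in> C"
    then have c: "c j \<in> {-1, 1}" if "j < k" for j
      using C(2) that by auto
    \<comment> \<open>Independence enters here: the constraint at the fresh coordinate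
      \<open>k\<close> contributes exactly one further factor \<open>p k\<close>.\<close>
    have "measure ?P (cylinder p (insert k {..<k}) (fun_upd c k 1))
        = p k * (\<Prod>j<k. if (fun_upd c k 1) j = 1 then p j else 1 - p j)"
      using c by (subst measure_cylinder[OF p]) auto
    also have "(\<Prod>j<k. if (fun_upd c k 1) j = 1 then p j else 1 - p j)
        = measure ?P (cylinder p {..<k} c)"
      using c by (subst measure_cylinder[OF p]) (auto intro!: prod.cong)
    finally show "measure ?P (cylinder p {..<k} c \<inter> cylinder p {k} (\<lambda>_. 1))
        = p k * measure ?P (cylinder p {..<k} c)"
      by (simp only: ins)
  qed
  also have "\<dots> = p k * measure ?P A"
    unfolding C(3) sum_distrib_left[symmetric]
    using disj C(1) by (subst finite_measure_finite_Union)
      (auto intro!: sets_rademacher_space_cylinder)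
  finally show ?thesis .
qed

text \<open>As coordinate \<open>k\<close> has two values, \<open>F\<close> equals \<open>F1\<close>
  times the indicator of \<open>?U\<close> plus \<open>F2\<close>, with both coefficients known
  before time \<open>k\<close>. They are taken out of the conditional expectation, and the indicator
  is replaced by its conditional probability \<open>p k\<close>.\<close>

lemma real_cond_exp_coord_filtration:
  fixes F :: "(nat \<Rightarrow> real) \<Rightarrow> real"
  assumes p: "\<And>k. 0 < p k \<and> p k < 1"
    and F: "F \<in> borel_measurable (coord_filtration p (int k))"
    and \<omega>: "\<omega> \<in> space (rademacher_space p)"
  shows "real_cond_exp (rademacher_space p) (coord_filtration p (int k - 1)) F \<omega>
    = p k * F (fun_upd \<omega> k 1) + (1 - p k) * F (fun_upd \<omega> k (-1))"
proof -
  let ?P = "rademacher_space p" and ?F = "coord_filtration p (int k - 1)"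
  let ?U = "cylinder p {k} (\<lambda>_. 1)"
  interpret prob_space ?P by (rule prob_space_rademacher_space[OF p])
  interpret finite_measure_subalgebra ?P ?F
    by unfold_locales (rule subalgebra_coord_filtration)
  \<comment> \<open>Overwriting coordinate \<open>k\<close> removes the dependence on it, so the
    index drops from \<open>int k\<close> to \<open>int k - 1\<close>.\<close>
  have F_upd: "(\<lambda>\<omega>. F (fun_upd \<omega> k x)) \<in> borel_measurable ?F" if "x \<in> {-1, 1}" for x
    using that by (intro borel_measurable_coord_filtrationI coord_filtration_measurable_cong[OF F]
        fun_upd_in_space) auto
  define F1 where "F1 \<omega> = F (fun_upd \<omega> k 1) - F (fun_upd \<omega> k (-1))" for \<omega>
  define F2 where "F2 \<omega> = F (fun_upd \<omega> k (-1))" for \<omega>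
  have F1 [measurable]: "F1 \<in> borel_measurable ?F" and F2 [measurable]: "F2 \<in> borel_measurable ?F"
    unfolding F1_def[abs_def] F2_def[abs_def] by (intro borel_measurable_diff F_upd; simp)+
  have U [measurable]: "?U \<in> sets ?P"
    by (simp add: sets_rademacher_space_cylinder)
  have int1: "integrable ?P (\<lambda>\<omega>. F1 \<omega> * indicator ?U \<omega>)"
    using integrable_mult_indicator[OF U integrable_coord_filtration[OF p F1]]
    by (simp add: mult.commute)
  have int2: "integrable ?P F2"
    by (rule integrable_coord_filtration[OF p F2])
  have F_eq: "F \<omega> = F1 \<omega> * indicator ?U \<omega> + F2 \<omega>" if "\<omega> \<in> space ?P" for \<omega>
  proof -
    have "\<omega> k = 1 \<or> \<omega> k = -1"
      using that by (auto simp: space_rademacher_space)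
    then have "fun_upd \<omega> k 1 = \<omega> \<and> \<omega> \<in> ?U \<or> fun_upd \<omega> k (-1) = \<omega> \<and> \<omega> \<notin> ?U"
      using that by (auto simp: cylinder_def)
    then show ?thesis
      by (auto simp: F1_def F2_def)
  qed
  have "AE \<omega> in ?P. real_cond_exp ?P ?F (indicator ?U) \<omega> = p k"
  proof (rule real_cond_exp_charact)
    fix A assume A: "A \<in> sets ?F"
    then have A': "A \<in> sets ?P"
      using subalg by (auto simp: subalgebra_def)
    then show "(\<integral>x\<in>A. indicator ?U x \<partial>?P) = (\<integral>x\<in>A. p k \<partial>?P)"
      using measure_Int_coord_eq_1[OF p A]
      by (simp add: set_lebesgue_integral_def indicator_inter_arith[symmetric] mult.commute)
  qed (simp_all add: less_top[symmetric])
  moreover have "AE \<omega> in ?P. real_cond_exp ?P ?F (\<lambda>\<omega>. F1 \<omega> * indicator ?U \<omega>) \<omega>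
      = F1 \<omega> * real_cond_exp ?P ?F (indicator ?U) \<omega>"
    using int1 by (intro real_cond_exp_mult) auto
  moreover have "AE \<omega> in ?P. real_cond_exp ?P ?F F2 \<omega> = F2 \<omega>"
    by (rule real_cond_exp_F_meas[OF int2 F2])
  moreover have "AE \<omega> in ?P. real_cond_exp ?P ?F (\<lambda>\<omega>. F1 \<omega> * indicator ?U \<omega> + F2 \<omega>) \<omega>
      = real_cond_exp ?P ?F (\<lambda>\<omega>. F1 \<omega> * indicator ?U \<omega>) \<omega> + real_cond_exp ?P ?F F2 \<omega>"
    by (rule real_cond_exp_add[OF int1 int2])
  moreover have "AE \<omega> in ?P. real_cond_exp ?P ?F F \<omega>
      = real_cond_exp ?P ?F (\<lambda>\<omega>. F1 \<omega> * indicator ?U \<omega> + F2 \<omega>) \<omega>"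
    using F_eq int1 int2 measurable_from_subalg[OF subalgebra_coord_filtration F]
    by (intro real_cond_exp_cong AE_I2) auto
  ultimately have "AE \<omega> in ?P. real_cond_exp ?P ?F F \<omega> = F1 \<omega> * p k + F2 \<omega>"
    by eventually_elim simp
  \<comment> \<open>Both sides are measurable with respect to \<open>?F\<close>, so the almost sure
    identity holds at \<omega> itself.\<close>
  then have "real_cond_exp ?P ?F F \<omega> = F1 \<omega> * p k + F2 \<omega>"
    by (intro coord_filtration_AE_eq_imp_eq[where n = "int k - 1", OF p _ _ _ \<omega>]) auto
  then show ?thesis
    by (simp add: F1_def F2_def algebra_simps)
qed

text \<open>The square roots cancel and leave the increment of \<open>F\<close> in coordinate
  \<open>k\<close> times \<open>(1 - 2 * p k + \<omega> k) / 2\<close>. This factor is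
  \<open>1 - p k\<close> at the value 1 and \<open>- p k\<close> at the value -1, which is also the
  weight of the increment in the deviation of \<open>F\<close> from its average.\<close>

lemma finite_difference_times_normalized_coord:
  assumes p: "0 < p k" "p k < 1" and \<omega>: "\<omega> \<in> space (rademacher_space p)"
  shows "finite_difference p k F \<omega> * normalized_coord p k \<omega>
    = F \<omega> - (p k * F (fun_upd \<omega> k 1) + (1 - p k) * F (fun_upd \<omega> k (-1)))"
proof -
  have "sqrt (p k * (1 - p k)) \<noteq> 0"
    using p by simp
  then have eq: "finite_difference p k F \<omega> * normalized_coord p k \<omega>
      = (F (fun_upd \<omega> k 1) - F (fun_upd \<omega> k (-1))) * (1 - 2 * p k + \<omega> k) / 2"
    by (simp add: finite_difference_def normalized_coord_def coord_def del: real_sqrt_eq_0_iff)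
  from \<omega> have "\<omega> k = 1 \<or> \<omega> k = -1"
    by (auto simp: space_rademacher_space)
  then show ?thesis
  proof
    assume k: "\<omega> k = 1"
    then have "fun_upd \<omega> k 1 = \<omega>" by (rule fun_upd_idem)
    then show ?thesis unfolding eq by (simp add: k) (simp add: field_simps)
  next
    assume k: "\<omega> k = -1"
    then have "fun_upd \<omega> k (-1) = \<omega>" by (rule fun_upd_idem)
    then show ?thesis unfolding eq by (simp add: k) (simp add: field_simps)
  qed
qed


section \<open>Telescoping the increments\<close>

theorem proposition14p1:
  fixes p :: "nat \<Rightarrow> real"
    and M :: "int \<Rightarrow> (nat \<Rightarrow> real) \<Rightarrow> real"
    and f :: "real \<Rightarrow> int \<Rightarrow> real"
    and n :: nat
    and \<omega> :: "nat \<Rightarrow> real"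
  assumes "\<And>k. 0 < p k \<and> p k < 1"
    and "square_integrable_martingale (rademacher_space p) {-1..} (coord_filtration p) M"
    and "\<omega> \<in> space (rademacher_space p)"
  shows "f (M (int n) \<omega>) (int n) =
      f (M (-1) \<omega>) (-1)
      + (\<Sum>k = 0..n. finite_difference p k (\<lambda>\<omega>'. f (M (int k) \<omega>') (int k)) \<omega>
                       * normalized_coord p k \<omega>)
      + (\<Sum>k = 0..n. real_cond_exp (rademacher_space p) (coord_filtration p (int k - 1))
                       (\<lambda>\<omega>'. f (M (int k) \<omega>') (int k) - f (M (int k - 1) \<omega>') (int k - 1)) \<omega>)"
proof -
  note p = assms(1)
  define Z where "Z m \<omega>' = f (M m \<omega>') m" for m \<omega>'
  have Z: "Z m \<in> borel_measurable (coord_filtration p m)" if "m \<ge> -1" for m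
  proof -
    have "M m \<in> borel_measurable (coord_filtration p m)"
      using assms(2) that by (auto simp: square_integrable_martingale_def)
    note M = coord_filtration_measurable_cong[OF this]
    show ?thesis
    proof (rule borel_measurable_coord_filtrationI)
      fix \<omega> \<omega>' :: "nat \<Rightarrow> real"
      assume "\<omega> \<in> space (rademacher_space p)" "\<omega>' \<in> space (rademacher_space p)"
        "\<And>k. int k \<le> m \<Longrightarrow> \<omega>' k = \<omega> k"
      then have "M m \<omega>' = M m \<omega>" by (intro M) auto
      then show "Z m \<omega>' = Z m \<omega>" by (simp add: Z_def)
    qed
  qed
  have step: "Z (int k) \<omega> - Z (int k - 1) \<omega>
      = finite_difference p k (Z (int k)) \<omega> * normalized_coord p k \<omega>
      + real_cond_exp (rademacher_space p) (coord_filtration p (int k - 1))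
          (\<lambda>\<omega>'. Z (int k) \<omega>' - Z (int k - 1) \<omega>') \<omega>" for k
  proof -
    \<comment> \<open>The earlier term does not see coordinate \<open>k\<close>; as the weights
      \<open>p k\<close> and \<open>1 - p k\<close> add up to 1, averaging leaves it
      unchanged.\<close>
    have upd: "Z (int k - 1) (fun_upd \<omega> k x) = Z (int k - 1) \<omega>" if "x \<in> {-1, 1}" for x
      using that assms(3)
      by (intro coord_filtration_measurable_cong[OF Z] fun_upd_in_space) auto
    have "Z (int k - 1) \<in> borel_measurable (coord_filtration p (int k))"
      by (intro borel_measurable_coord_filtrationI coord_filtration_measurable_cong[OF Z]) auto
    then have "(\<lambda>\<omega>'. Z (int k) \<omega>' - Z (int k - 1) \<omega>') \<in> borel_measurable (coord_filtration p (int k))"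
      using Z[of "int k"] by (intro borel_measurable_diff) auto
    from real_cond_exp_coord_filtration[OF p this assms(3)]
    have "real_cond_exp (rademacher_space p) (coord_filtration p (int k - 1))
          (\<lambda>\<omega>'. Z (int k) \<omega>' - Z (int k - 1) \<omega>') \<omega>
        = p k * Z (int k) (fun_upd \<omega> k 1) + (1 - p k) * Z (int k) (fun_upd \<omega> k (-1))
          - Z (int k - 1) \<omega>"
      by (simp add: upd algebra_simps)
    with finite_difference_times_normalized_coord[of p k \<omega> "Z (int k)"] p[of k] assms(3)
    show ?thesis
      by linarith
  qed
  \<comment> \<open>The increment for \<open>k = 0\<close> starts from
    \<open>int 0 - 1 = -1\<close>, which produces the initial term.\<close>
  have "Z (int n) \<omega> - Z (-1) \<omega> = (\<Sum>k = 0..n. Z (int k) \<omega> - Z (int k - 1) \<omega>)"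
    by (induction n) simp_all
  also have "\<dots> = (\<Sum>k = 0..n. finite_difference p k (Z (int k)) \<omega> * normalized_coord p k \<omega>)
      + (\<Sum>k = 0..n. real_cond_exp (rademacher_space p) (coord_filtration p (int k - 1))
          (\<lambda>\<omega>'. Z (int k) \<omega>' - Z (int k - 1) \<omega>') \<omega>)"
    unfolding step sum.distrib ..
  finally show ?thesis
    by (simp add: Z_def[abs_def])
qed

end
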